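(* Let $A$ be a $d\times d$ Metzler matrix with $\eta(A)>0$. Then Algorithm 1 (described in the context) computes an optimal solution to the problem $$\min\{\|X-A\|_{\max}\ :\ X\text{ Metzler},\ \eta(X)\leqslant 0\};$$ that is, the number $\tau_*$ it returns is the optimal value of this problem, and the matrix $A(\tau_* )$ is an optimal solution.
   Context: All matrices are real $d\times d$. A matrix is Metzler if all its off-diagonal entries are non-negative. $\eta(X)$ denotes the spectral abscissa (largest real part of the eigenvalues), $\rho(X)$ the spectral radius, and $\|X\|_{\max}=\max_{i,j}|x_{ij}|$. For $\tau\geqslant 0$, $A(\tau)$ denotes the Metzler matrix with entries $a_{ii}(\tau)=a_{ii}-\tau$ and $a_{ij}(\tau)=\max\{0,a_{ij}-\tau\}$ for $i\neq j$. Algorithm 1, with input a Metzler matrix $A$ with $\eta(A)>0$: Step 1. Sort all positive entries of $A$ in increasing order. If the highest entry is on the main diagonal, take $\tau_*=\max_i a_{ii}$ and finish. Otherwise go to Step 2. Step 2. Find (by bisection) the value $\tau_1$, the largest element $t$ of the set $\{0\}\cup\{a_{ij}\,:\,a_{ij}>0\}$ such that $\eta(A(t))>0$, and the value $\tau_2$, the smallest positive entry $t$ of $A$ such that $\eta(A(t))<0$. Step 3. Form the matrix $H=\dfrac{A(\tau_1)-A(\tau_2)}{\tau_2-\tau_1}$. Step 4. Compute $\tau_*=\tau_2-\dfrac{1}{\rho(-A(\tau_2)^{-1}H)}$.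
   Formalization: As printed, Algorithm 1 fails for A=[[1,1],[2,0]] (returns about 1.236, optimum 1). Here, if the highest entry is off-diagonal and some positive entry t has η(A(t))=0, the algorithm returns t; the τ1, τ2 formula of Steps 3-4 is used and verified only when no such entry exists. *)

theory Defs
  imports
    "Jordan_Normal_Form.Spectral_Radius"
    "Jordan_Normal_Form.Gauss_Jordan_Elimination"
begin

abbreviation complexify :: "real mat \<Rightarrow> complex mat" where
  "complexify X \<equiv> map_mat complex_of_real X"

definition spectral_abscissa :: "real mat \<Rightarrow> real" where
  "spectral_abscissa X = Max (Re ` spectrum (complexify X))"

definition metzler :: "real mat \<Rightarrow> bool" where
  "metzler X \<longleftrightarrow> (\<forall>i<dim_row X. \<forall>j<dim_col X. i \<noteq> j \<longrightarrow> 0 \<le> X $$ (i, j))"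

definition max_norm :: "real mat \<Rightarrow> real" where
  "max_norm X = Max (abs ` elements_mat X)"

definition reduced :: "real mat \<Rightarrow> real \<Rightarrow> real mat" where
  "reduced A t = mat (dim_row A) (dim_col A)
     (\<lambda>(i, j). if i = j then A $$ (i, i) - t else max 0 (A $$ (i, j) - t))"

definition stable_metzler :: "nat \<Rightarrow> real mat set" where
  "stable_metzler d = {X \<in> carrier_mat d d. metzler X \<and> spectral_abscissa X \<le> 0}"

definition positive_entries :: "real mat \<Rightarrow> real set" where
  "positive_entries A = {a \<in> elements_mat A. 0 < a}"

definition highest_on_diagonal :: "real mat \<Rightarrow> bool" where
  "highest_on_diagonal A \<longleftrightarrow>
     (\<exists>i<dim_row A. A $$ (i, i) \<in> positive_entries A \<and>
        (\<forall>a \<in> positive_entries A. a \<le> A $$ (i, i)))"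

text \<open>
  \<open>closest_stable_tau A \<tau>\<close>: on input \<open>A\<close> the algorithm runs to its end and returns \<open>\<tau>\<close>.
  It is a relation so that the existence of the two bisection values, the invertibility of
  \<open>A(\<tau>2)\<close> and the nonzero denominator are requirements of a successful run, not totalised away.

  Rule \<open>exact_root\<close>: the bisection stops at a positive entry \<open>t\<close> for which the abscissa of
  \<open>A(t)\<close> is exactly zero. Such a \<open>t\<close> would lie strictly between \<open>\<tau>1\<close> and \<open>\<tau>2\<close>; when it is an
  off-diagonal entry, \<open>A(\<tau>)\<close> need not be affine on that interval and the closing formula can fail.
  For the matrix with rows (1, 1) and (2, 0) the optimal value is 1, but \<open>\<tau>1 = 0\<close> and \<open>\<tau>2 = 2\<close>
  would give about 1.236.
\<close>

inductive closest_stable_tau :: "real mat \<Rightarrow> real \<Rightarrow> bool" for A :: "real mat" where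
  diagonal:
    "closest_stable_tau A (Max {A $$ (i, i) | i. i < dim_row A})"
    if "highest_on_diagonal A"
| exact_root:
    "closest_stable_tau A t"
    if "\<not> highest_on_diagonal A"
      and "t \<in> positive_entries A"
      and "spectral_abscissa (reduced A t) = 0"
| interpolation:
    "closest_stable_tau A (\<tau>2 - 1 / \<rho>)"
    if "\<not> highest_on_diagonal A"
      and "\<forall>t \<in> positive_entries A. spectral_abscissa (reduced A t) \<noteq> 0"
      and "\<tau>1 \<in> insert 0 (positive_entries A)"
      and "spectral_abscissa (reduced A \<tau>1) > 0"
      and "\<forall>t \<in> insert 0 (positive_entries A). spectral_abscissa (reduced A t) > 0 \<longrightarrow> t \<le> \<tau>1"
      and "\<tau>2 \<in> positive_entries A"
      and "spectral_abscissa (reduced A \<tau>2) < 0"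
      and "\<forall>t \<in> positive_entries A. spectral_abscissa (reduced A t) < 0 \<longrightarrow> \<tau>2 \<le> t"
      and "\<tau>1 \<noteq> \<tau>2"
      and "H = (1 / (\<tau>2 - \<tau>1)) \<cdot>\<^sub>m (reduced A \<tau>1 - reduced A \<tau>2)"
      and "mat_inverse (reduced A \<tau>2) = Some B"
      and "\<rho> = spectral_radius (complexify ((- B) * H))"
      and "\<rho> \<noteq> 0"

end

theory Submission
  imports Defs
begin

text \<open>
  For a Metzler matrix \<open>X\<close>, the abscissa satisfies \<open>\<eta>(X) < \<mu>\<close> iff \<open>X v < \<mu> v\<close> for some positive
  vector \<open>v\<close>. This criterion replaces Perron--Frobenius theory: it yields monotonicity of \<open>\<eta>\<close> and
  \<open>\<eta>(A(t)) + (t - s) \<le> \<eta>(A(s))\<close> for \<open>s \<le> t\<close>. Every Metzler matrix within distance \<open>r\<close> of \<open>A\<close> dominates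
  \<open>A(r)\<close>, so the unique root of \<open>\<eta>(A(\<tau>)) = 0\<close> is the optimal value. Between \<open>\<tau>1\<close> and \<open>\<tau>2\<close> no entry of
  \<open>A\<close> is crossed, so \<open>A(\<tau>2 - s) = A(\<tau>2) + s H\<close>, and since \<open>-A(\<tau>2)\<^sup>-\<^sup>1 \<ge> 0\<close> this matrix has negative abscissa
  iff \<open>s \<rho>(-A(\<tau>2)\<^sup>-\<^sup>1 H) < 1\<close>; the root is therefore \<open>s = 1 / \<rho>\<close>.
\<close>

section \<open>Subinvariant vectors and complex spectra\<close>

text \<open>The strict form of the Collatz-Wielandt certificate. Strictness lets the vector be
  positive in every coordinate even for reducible matrices, whose Perron eigenvector may have zero
  entries.\<close>

definition subinvariant :: "real mat \<Rightarrow> real \<Rightarrow> real vec \<Rightarrow> bool" where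
  "subinvariant X \<mu> v \<longleftrightarrow> v \<in> carrier_vec (dim_row X) \<and>
     (\<forall>i<dim_row X. 0 < v $ i \<and> (X *\<^sub>v v) $ i < \<mu> * v $ i)"

lemma mult_mat_vec_nth:
  assumes "X \<in> carrier_mat n d" "v \<in> carrier_vec d" "i < n"
  shows "(X *\<^sub>v v) $ i = (\<Sum>j<d. X $$ (i, j) * v $ j)"
  using assms by (auto simp: scalar_prod_def atLeast0LessThan intro!: sum.cong)

lemma subinvariantD:
  assumes "X \<in> carrier_mat d d" "subinvariant X \<mu> v"
  shows "v \<in> carrier_vec d" "i < d \<Longrightarrow> 0 < v $ i"
    "i < d \<Longrightarrow> (\<Sum>j<d. X $$ (i, j) * v $ j) < \<mu> * v $ i"
  using assms mult_mat_vec_nth[of X d d v i] unfolding subinvariant_def by auto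

lemma subinvariantI:
  assumes "X \<in> carrier_mat d d" "v \<in> carrier_vec d" "\<And>i. i < d \<Longrightarrow> 0 < v $ i"
    "\<And>i. i < d \<Longrightarrow> (\<Sum>j<d. X $$ (i, j) * v $ j) < \<mu> * v $ i"
  shows "subinvariant X \<mu> v"
  using assms mult_mat_vec_nth[of X d d v] unfolding subinvariant_def by auto

lemma metzlerD:
  assumes "X \<in> carrier_mat d d" "metzler X" "i < d" "j < d" "i \<noteq> j"
  shows "0 \<le> X $$ (i, j)"
  using assms unfolding metzler_def by auto

lemma metzler_nonneg:
  assumes "X \<in> carrier_mat d d" "\<And>i j. i < d \<Longrightarrow> j < d \<Longrightarrow> 0 \<le> X $$ (i, j)"
  shows "metzler X"
  using assms unfolding metzler_def by auto

lemma spectrum_iff: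
  assumes "C \<in> carrier_mat d d"
  shows "z \<in> spectrum C \<longleftrightarrow> (\<exists>x \<in> carrier_vec d. x \<noteq> 0\<^sub>v d \<and> C *\<^sub>v x = z \<cdot>\<^sub>v x)"
  using assms unfolding spectrum_def eigenvalue_def eigenvector_def by auto

text \<open>The spectrum is finite and, for \<open>0 < d\<close>, nonempty, so \<open>Max\<close> is
  a true maximum and can be compared elementwise.\<close>

lemma spectrum_bounds:
  assumes "X \<in> carrier_mat d d" "0 < d"
  shows "spectral_abscissa X < \<mu> \<longleftrightarrow> (\<forall>z \<in> spectrum (complexify X). Re z < \<mu>)"
    and "spectral_radius (complexify X) < \<mu> \<longleftrightarrow> (\<forall>z \<in> spectrum (complexify X). cmod z < \<mu>)"
proof -
  have "complexify X \<in> carrier_mat d d" using assms by auto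
  then have "finite (spectrum (complexify X))" "spectrum (complexify X) \<noteq> {}"
    by (rule card_finite_spectrum(1), rule spectrum_non_empty[OF _ assms(2)])
  then show "spectral_abscissa X < \<mu> \<longleftrightarrow> (\<forall>z \<in> spectrum (complexify X). Re z < \<mu>)"
    and "spectral_radius (complexify X) < \<mu> \<longleftrightarrow> (\<forall>z \<in> spectrum (complexify X). cmod z < \<mu>)"
    unfolding spectral_abscissa_def spectral_radius_def by auto
qed

section \<open>From a subinvariant vector to a spectral bound\<close>

lemma obtain_arg_max_below:
  fixes f :: "nat \<Rightarrow> real"
  assumes "0 < d"
  obtains i where "i < d" "\<And>j. j < d \<Longrightarrow> f j \<le> f i"
proof -
  have "Max (f ` {..<d}) \<in> f ` {..<d}" using assms by (intro Max_in) auto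
  then obtain i where "i < d" "f i = Max (f ` {..<d})" by auto
  moreover have "f j \<le> Max (f ` {..<d})" if "j < d" for j using that by (intro Max_ge) auto
  ultimately show ?thesis using that by metis
qed

text \<open>Gershgorin discs for the norm weighted by \<open>v\<close>.\<close>

lemma spectrum_in_disc:
  assumes X: "X \<in> carrier_mat d d" and d: "0 < d" and m: "metzler X"
    and v: "subinvariant X \<mu> v" and l: "z \<in> spectrum (complexify X)"
  obtains i where "i < d" "cmod (z - complex_of_real (X $$ (i, i))) < \<mu> - X $$ (i, i)"
proof -
  note vD = subinvariantD[OF X v]
  have C: "complexify X \<in> carrier_mat d d" using X by auto
  obtain x where x: "x \<in> carrier_vec d" "x \<noteq> 0\<^sub>v d" and ev: "complexify X *\<^sub>v x = z \<cdot>\<^sub>v x"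
    using l spectrum_iff[OF C] by auto
  \<comment> \<open>Row \<open>i\<close> is where the eigenvector is largest in the sup norm
    weighted by \<open>v\<close>; every coordinate is then at most
    \<open>\<theta> * v $ j\<close>.\<close>
  obtain i where i: "i < d" and mx: "\<And>j. j < d \<Longrightarrow> cmod (x $ j) / v $ j \<le> cmod (x $ i) / v $ i"
    using obtain_arg_max_below[OF d, of "\<lambda>j. cmod (x $ j) / v $ j"] by blast
  define \<theta> where "\<theta> = cmod (x $ i) / v $ i"
  have xi: "cmod (x $ i) = \<theta> * v $ i" using vD(2)[OF i] unfolding \<theta>_def by auto
  have xj: "cmod (x $ j) \<le> \<theta> * v $ j" if "j < d" for j
    using mx[OF that] vD(2)[OF that] unfolding \<theta>_def by (simp add: pos_divide_le_eq)
  have \<theta>: "0 < \<theta>"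
  proof (rule ccontr)
    assume "\<not> 0 < \<theta>"
    then have "cmod (x $ j) \<le> 0" if "j < d" for j
      using xj[OF that] vD(2)[OF that] by (smt (verit) mult_nonpos_nonneg)
    then have "x = 0\<^sub>v d" using x(1) by (intro eq_vecI) auto
    with x(2) show False by simp
  qed
  \<comment> \<open>Stated for every commutative monoid because it is applied to a complex sum and
    to a real one.\<close>
  have split: "(\<Sum>j<d. g j) = g i + (\<Sum>j\<in>{..<d}-{i}. g j)" for g :: "nat \<Rightarrow> 'a::comm_monoid_add"
    using i by (intro sum.remove) auto
  have "(\<Sum>j<d. complex_of_real (X $$ (i, j)) * x $ j) = z * x $ i"
    using arg_cong[OF ev, of "\<lambda>w. w $ i"] mult_mat_vec_nth[OF C x(1) i] i x(1) X by simp
  then have "(z - complex_of_real (X $$ (i, i))) * x $ i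
      = (\<Sum>j\<in>{..<d}-{i}. complex_of_real (X $$ (i, j)) * x $ j)"
    unfolding split by (simp add: algebra_simps)
  then have "cmod (z - complex_of_real (X $$ (i, i))) * cmod (x $ i)
      = cmod (\<Sum>j\<in>{..<d}-{i}. complex_of_real (X $$ (i, j)) * x $ j)"
    by (metis norm_mult)
  also have "\<dots> \<le> (\<Sum>j\<in>{..<d}-{i}. cmod (complex_of_real (X $$ (i, j)) * x $ j))"
    by (rule norm_sum)
  also have "\<dots> \<le> (\<Sum>j\<in>{..<d}-{i}. \<theta> * (X $$ (i, j) * v $ j))"
  proof (rule sum_mono)
    fix j assume j: "j \<in> {..<d}-{i}"
    then have "0 \<le> X $$ (i, j)" using metzlerD[OF X m i] by auto
    then have "cmod (complex_of_real (X $$ (i, j)) * x $ j) \<le> X $$ (i, j) * (\<theta> * v $ j)"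
      using xj[of j] j by (simp add: norm_mult mult_left_mono)
    then show "cmod (complex_of_real (X $$ (i, j)) * x $ j) \<le> \<theta> * (X $$ (i, j) * v $ j)"
      by (simp add: ac_simps)
  qed
  also have "\<dots> = \<theta> * ((\<Sum>j<d. X $$ (i, j) * v $ j) - X $$ (i, i) * v $ i)"
    unfolding split by (simp add: sum_distrib_left)
  also have "\<dots> < \<theta> * (\<mu> * v $ i - X $$ (i, i) * v $ i)"
    using vD(3)[OF i] \<theta> by simp
  also have "\<dots> = (\<mu> - X $$ (i, i)) * cmod (x $ i)"
    by (simp add: xi algebra_simps)
  finally have "cmod (z - complex_of_real (X $$ (i, i))) < \<mu> - X $$ (i, i)"
    using mult_right_less_imp_less[of _ "cmod (x $ i)"] by force
  with i show ?thesis using that by blast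
qed

text \<open>A disc around the real point \<open>X $$ (i, i)\<close> of radius less than
  \<open>\<mu> - X $$ (i, i)\<close> stays to the left of \<open>\<mu>\<close>.\<close>

lemma abscissa_less_if_subinvariant:
  assumes "X \<in> carrier_mat d d" "0 < d" "metzler X" "subinvariant X \<mu> v"
  shows "spectral_abscissa X < \<mu>"
proof -
  have "Re z < \<mu>" if z: "z \<in> spectrum (complexify X)" for z
  proof -
    obtain i where "cmod (z - complex_of_real (X $$ (i, i))) < \<mu> - X $$ (i, i)"
      using spectrum_in_disc[OF assms z] by blast
    then show ?thesis
      using complex_Re_le_cmod[of "z - complex_of_real (X $$ (i, i))"] by simp
  qed
  then show ?thesis using spectrum_bounds(1)[OF assms(1,2)] by blast
qed

text \<open>With a nonnegative centre, such a disc also lies inside the disc of radius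
  \<open>r\<close> around the origin.\<close>

lemma radius_less_if_subinvariant:
  assumes "X \<in> carrier_mat d d" "0 < d" "subinvariant X r v"
    and nn: "\<And>i j. i < d \<Longrightarrow> j < d \<Longrightarrow> 0 \<le> X $$ (i, j)"
  shows "spectral_radius (complexify X) < r"
proof -
  have "cmod z < r" if l: "z \<in> spectrum (complexify X)" for z
  proof -
    obtain i where i: "i < d" "cmod (z - complex_of_real (X $$ (i, i))) < r - X $$ (i, i)"
      using spectrum_in_disc[OF assms(1,2) metzler_nonneg[OF assms(1) nn] assms(3) l] by blast
    then show ?thesis
      using norm_triangle_sub[of z "complex_of_real (X $$ (i, i))"] nn[OF i(1) i(1)] by simp
  qed
  then show ?thesis using spectrum_bounds(2)[OF assms(1,2)] by blast
qed

section \<open>From a spectral bound to a subinvariant vector\<close>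

text \<open>\<open>pow_mat\<close> multiplies the new factor on the right, so moving it to the left
  takes an induction.\<close>

lemma pow_mat_mult_vec:
  assumes "P \<in> carrier_mat d d" "x \<in> carrier_vec d"
  shows "(P ^\<^sub>m Suc k) *\<^sub>v x = P *\<^sub>v (P ^\<^sub>m k *\<^sub>v x)"
  using assms
proof (induction k arbitrary: x)
  case (Suc k)
  have "(P ^\<^sub>m Suc (Suc k)) *\<^sub>v x = (P ^\<^sub>m Suc k) *\<^sub>v (P *\<^sub>v x)"
    using Suc.prems by (subst pow_mat.simps) (auto intro!: assoc_mult_mat_vec[of _ d d _ d])
  also have "\<dots> = P *\<^sub>v (P ^\<^sub>m k *\<^sub>v (P *\<^sub>v x))"
    using Suc by auto
  also have "P ^\<^sub>m k *\<^sub>v (P *\<^sub>v x) = P ^\<^sub>m Suc k *\<^sub>v x"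
    using Suc.prems by (auto intro!: assoc_mult_mat_vec[symmetric, of _ d d _ d])
  finally show ?case .
qed auto

lemma spectrum_smult:
  assumes "C \<in> carrier_mat d d" "c \<noteq> 0" "z \<in> spectrum (c \<cdot>\<^sub>m C)"
  shows "z / c \<in> spectrum (C :: complex mat)"
proof -
  obtain x where x: "x \<in> carrier_vec d" "x \<noteq> 0\<^sub>v d" "(c \<cdot>\<^sub>m C) *\<^sub>v x = z \<cdot>\<^sub>v x"
    using assms spectrum_iff[of "c \<cdot>\<^sub>m C" d] by auto
  have "C *\<^sub>v x = (z / c) \<cdot>\<^sub>v x"
  proof (rule eq_vecI)
    fix i assume "i < dim_vec ((z / c) \<cdot>\<^sub>v x)"
    then have i: "i < d" using x by auto
    have "((c \<cdot>\<^sub>m C) *\<^sub>v x) $ i = c * (C *\<^sub>v x) $ i"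
      using mult_mat_vec_nth[OF assms(1) x(1) i] mult_mat_vec_nth[of "c \<cdot>\<^sub>m C" d d x i] assms x(1) i
      by (simp add: sum_distrib_left mult.assoc)
    then show "(C *\<^sub>v x) $ i = ((z / c) \<cdot>\<^sub>v x) $ i"
      using x i assms by (simp add: field_simps)
  qed (use x assms in auto)
  then show ?thesis using x spectrum_iff[OF assms(1)] by blast
qed

text \<open>A truncated Neumann series supplies the vector: with \<open>r' < r\<close> still above the spectral
  radius, \<open>(X / r')^k 1\<close> stays bounded, so the remainder of the series for \<open>(1 - X / r)\<^sup>-\<^sup>1 1\<close>
  falls below \<open>1\<close>.\<close>

lemma subinvariant_if_radius_less:
  assumes X: "X \<in> carrier_mat d d" and d: "0 < d"
    and nn: "\<And>i j. i < d \<Longrightarrow> j < d \<Longrightarrow> 0 \<le> X $$ (i, j)"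
    and sr: "spectral_radius (complexify X) < r"
  shows "\<exists>v. subinvariant X r v"
proof -
  have C: "complexify X \<in> carrier_mat d d" using X by auto
  have "0 \<le> spectral_radius (complexify X)"
    using spectral_radius_mem_max(1)[OF C d] by auto
  \<comment> \<open>The gap between \<open>r'\<close> and \<open>r\<close> makes the ratio
    \<open>t = r' / r\<close> smaller than 1, which produces the geometric decay below.\<close>
  with sr obtain r' where r': "spectral_radius (complexify X) < r'" "r' < r" "0 < r'"
    by (metis dense order.strict_trans1)
  define P where "P = (1 / r') \<cdot>\<^sub>m X"
  have P: "P \<in> carrier_mat d d" using X unfolding P_def by auto
  have cP: "complexify P = complex_of_real (1 / r') \<cdot>\<^sub>m complexify X"
    unfolding P_def using X by (intro eq_matI) auto
  have "cmod z < 1" if "z \<in> spectrum (complexify P)" for z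
  proof -
    have "z / complex_of_real (1 / r') \<in> spectrum (complexify X)"
      using that r' unfolding cP by (intro spectrum_smult[OF C]) auto
    then have "cmod (z / complex_of_real (1 / r')) < r'"
      using spectrum_bounds(2)[OF X d] r' by blast
    then show ?thesis using r' by (simp add: norm_mult norm_divide)
  qed
  then have "spectral_radius (complexify P) < 1" using spectrum_bounds(2)[OF P d] by blast
  then obtain c where c: "\<And>k. norm_bound (complexify P ^\<^sub>m k) c"
    using spectral_radius_jnf_norm_bound_less_1_upper_triangular[of "complexify P" d] P by auto
  have cpow: "complexify P ^\<^sub>m k = complexify (P ^\<^sub>m k)" for k
    using of_real_hom.mat_hom_pow[OF P] by metis
  have Pk: "\<bar>(P ^\<^sub>m k) $$ (i, j)\<bar> \<le> c" if "i < d" "j < d" for i j k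
    using c[of k] P that unfolding cpow norm_bound_def by auto
  define u where "u k = (P ^\<^sub>m k) *\<^sub>v (vec d (\<lambda>_. 1))" for k
  have uc: "u k \<in> carrier_vec d" for k unfolding u_def using P by (intro mult_mat_vec_carrier[of _ d d] pow_carrier_mat) auto
  have u0: "u 0 = vec d (\<lambda>_. 1)" unfolding u_def using P by auto
  have uS: "u (Suc k) = P *\<^sub>v u k" for k unfolding u_def using P by (intro pow_mat_mult_vec) auto
  have uSn: "r' * u (Suc k) $ i = (\<Sum>j<d. X $$ (i, j) * u k $ j)" if "i < d" for k i
  proof -
    have "u (Suc k) $ i = (\<Sum>j<d. P $$ (i, j) * u k $ j)"
      unfolding uS by (rule mult_mat_vec_nth[OF P uc that])
    then show ?thesis
      using that X r' by (simp add: P_def sum_divide_distrib[symmetric])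
  qed
  have unn: "0 \<le> u k $ i" if "i < d" for k i
    using that
  proof (induction k arbitrary: i)
    case (Suc k)
    then have "0 \<le> r' * u (Suc k) $ i" unfolding uSn[OF Suc.prems] by (intro sum_nonneg) (simp add: nn)
    then show ?case using r' by (simp add: zero_le_mult_iff)
  qed (simp add: u0)
  have ub: "u k $ i \<le> real d * c" if "i < d" for k i
  proof -
    have "u k $ i = (\<Sum>j<d. (P ^\<^sub>m k) $$ (i, j))"
      unfolding u_def using mult_mat_vec_nth[of "P ^\<^sub>m k" d d _ i] P that by simp
    also have "\<dots> \<le> (\<Sum>j<d. c)"
      by (intro sum_mono) (use Pk that in \<open>auto simp: abs_le_iff\<close>)
    finally show ?thesis by simp
  qed
  define t where "t = r' / r"
  have t: "0 < t" "t < 1" "r' = r * t" using r' unfolding t_def by auto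
  have "(\<lambda>n. t ^ n * (real d * c)) \<longlonglongrightarrow> 0 * (real d * c)"
    using t by (intro tendsto_mult LIMSEQ_power_zero tendsto_const) auto
  then have "\<forall>\<^sub>F n in sequentially. t ^ n * (real d * c) < 1" by (intro order_tendstoD) auto
  then obtain n where "t ^ Suc n * (real d * c) < 1"
    unfolding eventually_sequentially using le_SucI by blast
  then have un: "t ^ Suc n * u (Suc n) $ i < 1" if "i < d" for i
    using ub[OF that, of "Suc n"] t by (smt (verit) mult_left_mono zero_less_power)
  \<comment> \<open>Since \<open>X = r * t * P\<close> and \<open>u k\<close> is \<open>P^k\<close>
    applied to the all-ones vector, this is a partial sum of the Neumann series of
    \<open>X / r\<close>.\<close>
  define v where "v = vec d (\<lambda>i. \<Sum>k<Suc n. t ^ k * u k $ i)"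
  have "subinvariant X r v"
  proof (rule subinvariantI[OF X])
    fix i assume i: "i < d"
    \<comment> \<open>Multiplying by \<open>X / r\<close> shifts the index: the term
      \<open>u 0 = 1\<close> drops out and the remainder, less than 1, enters. Both positivity and
      the strict inequality follow.\<close>
    have shift: "(\<Sum>k<Suc n. t ^ Suc k * u (Suc k) $ i) + 1 = v $ i + t ^ Suc n * u (Suc n) $ i"
      using sum.lessThan_Suc_shift[of "\<lambda>k. t ^ k * u k $ i" "Suc n"] i unfolding v_def u0 by simp
    have "0 \<le> (\<Sum>k<Suc n. t ^ Suc k * u (Suc k) $ i)"
      by (intro sum_nonneg) (use t unn i in auto)
    with shift un[OF i] show "0 < v $ i" by linarith
    have "(\<Sum>j<d. X $$ (i, j) * v $ j) = (\<Sum>j<d. \<Sum>k<Suc n. t ^ k * (X $$ (i, j) * u k $ j))"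
      unfolding v_def by (intro sum.cong) (auto simp: sum_distrib_left algebra_simps)
    also have "\<dots> = (\<Sum>k<Suc n. \<Sum>j<d. t ^ k * (X $$ (i, j) * u k $ j))" by (rule sum.swap)
    also have "\<dots> = (\<Sum>k<Suc n. t ^ k * (r' * u (Suc k) $ i))"
      unfolding uSn[OF i] by (simp add: sum_distrib_left)
    also have "\<dots> = r * (\<Sum>k<Suc n. t ^ Suc k * u (Suc k) $ i)"
      unfolding t(3) by (simp only: sum_distrib_left) (intro sum.cong, auto)
    also have "\<dots> < r * v $ i" using shift un[OF i] r' by simp
    finally show "(\<Sum>j<d. X $$ (i, j) * v $ j) < r * v $ i" .
  qed (simp add: v_def)
  then show ?thesis ..
qed

text \<open>Once \<open>c + \<mu>\<close> is positive, squaring reduces the claim to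
  \<open>(Im z)^2 < (\<mu> - Re z) * (2 * c + \<mu> + Re z)\<close>, whose right side grows linearly
  in \<open>c\<close>.\<close>

lemma eventually_cmod_shift_less:
  fixes z :: complex
  assumes "Re z < \<mu>"
  shows "\<forall>\<^sub>F c in at_top. cmod (z + complex_of_real c) < c + \<mu>"
  using eventually_ge_at_top[of "\<bar>\<mu>\<bar> + \<bar>Re z\<bar> + 1 + (Im z)\<^sup>2 / (\<mu> - Re z)"]
proof eventually_elim
  case (elim c)
  define q where "q = (Im z)\<^sup>2 / (\<mu> - Re z)"
  have q: "0 \<le> q" "(Im z)\<^sup>2 = (\<mu> - Re z) * q" using assms unfolding q_def by auto
  have c: "q < 2 * c + \<mu> + Re z" "0 < c + \<mu>" using elim q unfolding q_def[symmetric] by linarith+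
  have "(\<mu> - Re z) * q < (\<mu> - Re z) * (2 * c + \<mu> + Re z)"
    using c assms by (intro mult_strict_left_mono) auto
  then have "(cmod (z + complex_of_real c))\<^sup>2 < (c + \<mu>)\<^sup>2"
    unfolding cmod_power2 using q by (simp add: power2_eq_square algebra_simps)
  then show ?case using c by (simp add: power2_less_imp_less)
qed

lemma spectrum_add_scalar:
  assumes X: "X \<in> carrier_mat d d" and l: "z \<in> spectrum (X + c \<cdot>\<^sub>m 1\<^sub>m d)"
  shows "z - c \<in> spectrum (X :: complex mat)"
proof -
  have Xc: "X + c \<cdot>\<^sub>m 1\<^sub>m d \<in> carrier_mat d d" using X by auto
  obtain x where x: "x \<in> carrier_vec d" "x \<noteq> 0\<^sub>v d" "(X + c \<cdot>\<^sub>m 1\<^sub>m d) *\<^sub>v x = z \<cdot>\<^sub>v x"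
    using l spectrum_iff[OF Xc] by auto
  have "X *\<^sub>v x = (z - c) \<cdot>\<^sub>v x"
  proof (rule eq_vecI)
    fix i assume "i < dim_vec ((z - c) \<cdot>\<^sub>v x)"
    then have i: "i < d" using x by auto
    have "z * x $ i = (\<Sum>j<d. (X + c \<cdot>\<^sub>m 1\<^sub>m d) $$ (i, j) * x $ j)"
      using mult_mat_vec_nth[OF Xc x(1) i] i x by simp
    also have "\<dots> = (\<Sum>j<d. X $$ (i, j) * x $ j + (if i = j then c * x $ j else 0))"
      using i X by (intro sum.cong) (auto simp: algebra_simps)
    also have "\<dots> = (X *\<^sub>v x) $ i + c * x $ i"
      using mult_mat_vec_nth[OF X x(1) i] i by (simp add: sum.distrib)
    finally show "(X *\<^sub>v x) $ i = ((z - c) \<cdot>\<^sub>v x) $ i"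
      using i x by (simp add: algebra_simps)
  qed (use x X in auto)
  then show ?thesis using x spectrum_iff[OF X] by blast
qed

text \<open>For large \<open>c\<close> the half plane \<open>Re z < \<mu>\<close> looks like the disc of radius \<open>c + \<mu>\<close> around \<open>-c\<close>,
  so the spectral radius of \<open>X + c\<close> controls the abscissa of \<open>X\<close>; no dominant eigenvalue is needed.\<close>

lemma subinvariant_if_abscissa_less:
  assumes X: "X \<in> carrier_mat d d" and d: "0 < d" and m: "metzler X"
    and sa: "spectral_abscissa X < \<mu>"
  shows "\<exists>v. subinvariant X \<mu> v"
proof -
  have C: "complexify X \<in> carrier_mat d d" using X by auto
  have "\<forall>\<^sub>F c in at_top. \<forall>z \<in> spectrum (complexify X). cmod (z + complex_of_real c) < c + \<mu>"
    using spectrum_bounds(1)[OF X d] sa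
    by (intro eventually_ball_finite card_finite_spectrum[OF C]) (auto intro: eventually_cmod_shift_less)
  moreover have "\<forall>\<^sub>F c in at_top. \<forall>i\<in>{..<d}. - X $$ (i, i) \<le> c"
    by (intro eventually_ball_finite) auto
  ultimately have "\<forall>\<^sub>F c in at_top. (\<forall>z \<in> spectrum (complexify X). cmod (z + complex_of_real c) < c + \<mu>)
      \<and> (\<forall>i\<in>{..<d}. - X $$ (i, i) \<le> c)"
    by (rule eventually_conj)
  \<comment> \<open>One \<open>c\<close> serves the whole spectrum, which is finite, and also makes
    the diagonal of \<open>X + c\<close> nonnegative.\<close>
  then obtain c where c: "\<And>z. z \<in> spectrum (complexify X) \<Longrightarrow> cmod (z + complex_of_real c) < c + \<mu>"
    and cd: "\<And>i. i < d \<Longrightarrow> - X $$ (i, i) \<le> c"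
    using eventually_happens[of _ "at_top :: real filter"] by fastforce
  define Q where "Q = X + c \<cdot>\<^sub>m 1\<^sub>m d"
  have Q: "Q \<in> carrier_mat d d" using X unfolding Q_def by auto
  have Qn: "Q $$ (i, j) = X $$ (i, j) + (if i = j then c else 0)" if "i < d" "j < d" for i j
    using that X unfolding Q_def by simp
  have cQ: "complexify Q = complexify X + complex_of_real c \<cdot>\<^sub>m 1\<^sub>m d"
    unfolding Q_def using X by (intro eq_matI) auto
  have "cmod z < c + \<mu>" if "z \<in> spectrum (complexify Q)" for z
    using c[OF spectrum_add_scalar[OF C that[unfolded cQ]]] by simp
  then have "spectral_radius (complexify Q) < c + \<mu>" using spectrum_bounds(2)[OF Q d] by blast
  moreover have "0 \<le> Q $$ (i, j)" if "i < d" "j < d" for i j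
    using Qn[OF that] metzlerD[OF X m that] cd[OF that(1)] by (cases "i = j") auto
  ultimately obtain v where v: "subinvariant Q (c + \<mu>) v"
    using subinvariant_if_radius_less[OF Q d] by blast
  note vD = subinvariantD[OF Q v]
  have "subinvariant X \<mu> v"
  proof (rule subinvariantI[OF X vD(1,2)])
    fix i assume i: "i < d"
    have "(\<Sum>j<d. Q $$ (i, j) * v $ j) = (\<Sum>j<d. X $$ (i, j) * v $ j) + (\<Sum>j<d. (if i = j then c * v $ j else 0))"
      unfolding sum.distrib[symmetric] by (intro sum.cong) (auto simp: Qn i algebra_simps)
    also have "(\<Sum>j<d. (if i = j then c * v $ j else 0)) = c * v $ i" using i by simp
    finally show "(\<Sum>j<d. X $$ (i, j) * v $ j) < \<mu> * v $ i"
      using vD(3)[OF i] by (simp add: algebra_simps)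
  qed
  then show ?thesis ..
qed

section \<open>Comparison of spectral abscissas\<close>

lemma abscissa_less_iff:
  assumes "X \<in> carrier_mat d d" "0 < d" "metzler X"
  shows "spectral_abscissa X < \<mu> \<longleftrightarrow> (\<exists>v. subinvariant X \<mu> v)"
  using assms abscissa_less_if_subinvariant subinvariant_if_abscissa_less by blast

text \<open>Since a subinvariant vector of \<open>Y\<close> is positive, the entrywise bound turns
  it into one of \<open>X\<close>. The case \<open>\<theta> = 1\<close> is monotonicity with a
  shift; smaller \<open>\<theta>\<close> serve convex combinations.\<close>

lemma abscissa_affine_mono:
  assumes X: "X \<in> carrier_mat d d" "metzler X" and Y: "Y \<in> carrier_mat d d" "metzler Y"
    and d: "0 < d" and \<theta>: "0 < \<theta>"
    and le: "\<And>i j. i < d \<Longrightarrow> j < d \<Longrightarrow> \<theta> * X $$ (i, j) - (if i = j then c else 0) \<le> Y $$ (i, j)"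
  shows "\<theta> * spectral_abscissa X - c \<le> spectral_abscissa Y"
proof (rule ccontr)
  assume "\<not> ?thesis"
  then obtain v where v: "subinvariant Y (\<theta> * spectral_abscissa X - c) v"
    using abscissa_less_iff[OF Y(1) d Y(2)] by (meson not_le)
  note vD = subinvariantD[OF Y(1) v]
  have "subinvariant X (spectral_abscissa X) v"
  proof (rule subinvariantI[OF X(1) vD(1,2)])
    fix i assume i: "i < d"
    have "\<theta> * (\<Sum>j<d. X $$ (i, j) * v $ j) - c * v $ i
        = (\<Sum>j<d. (\<theta> * X $$ (i, j)) * v $ j - (if i = j then c * v $ j else 0))"
      using i by (simp add: sum_subtractf sum_distrib_left mult.assoc)
    also have "\<dots> = (\<Sum>j<d. (\<theta> * X $$ (i, j) - (if i = j then c else 0)) * v $ j)"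
      by (intro sum.cong) (auto simp: algebra_simps)
    also have "\<dots> \<le> (\<Sum>j<d. Y $$ (i, j) * v $ j)"
    proof (rule sum_mono)
      fix j assume "j \<in> {..<d}"
      then show "(\<theta> * X $$ (i, j) - (if i = j then c else 0)) * v $ j \<le> Y $$ (i, j) * v $ j"
        using le[OF i, of j] vD(2)[of j] by (intro mult_right_mono) auto
    qed
    also have "\<dots> < \<theta> * (spectral_abscissa X * v $ i) - c * v $ i"
      using vD(3)[OF i] by (simp add: algebra_simps)
    finally show "(\<Sum>j<d. X $$ (i, j) * v $ j) < spectral_abscissa X * v $ i"
      using \<theta> by simp
  qed
  then show False using abscissa_less_iff[OF X(1) d X(2)] by blast
qed

text \<open>In row \<open>i\<close> the off-diagonal terms add a nonnegative amount, so no positive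
  vector is subinvariant at the level \<open>X $$ (i, i)\<close>.\<close>

lemma diagonal_le_abscissa:
  assumes X: "X \<in> carrier_mat d d" "metzler X" and i: "i < d"
  shows "X $$ (i, i) \<le> spectral_abscissa X"
proof (rule ccontr)
  assume "\<not> ?thesis"
  moreover have "0 < d" using i by simp
  ultimately obtain v where v: "subinvariant X (X $$ (i, i)) v"
    using abscissa_less_iff[OF X(1) _ X(2)] by (meson not_le)
  note vD = subinvariantD[OF X(1) v]
  have "0 \<le> (\<Sum>j\<in>{..<d}-{i}. X $$ (i, j) * v $ j)"
  proof (rule sum_nonneg)
    fix j assume "j \<in> {..<d}-{i}"
    then show "0 \<le> X $$ (i, j) * v $ j" using metzlerD[OF X i, of j] vD(2)[of j] by auto
  qed
  moreover have "(\<Sum>j<d. X $$ (i, j) * v $ j) = X $$ (i, i) * v $ i + (\<Sum>j\<in>{..<d}-{i}. X $$ (i, j) * v $ j)"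
    using i by (intro sum.remove) auto
  ultimately show False using vD(3)[OF i] by simp
qed

lemma abscissa_diagonal_less:
  assumes X: "X \<in> carrier_mat d d" and d: "0 < d"
    and off: "\<And>i j. i < d \<Longrightarrow> j < d \<Longrightarrow> i \<noteq> j \<Longrightarrow> X $$ (i, j) = 0"
    and diag: "\<And>i. i < d \<Longrightarrow> X $$ (i, i) < \<mu>"
  shows "spectral_abscissa X < \<mu>"
proof -
  have "metzler X" using X off unfolding metzler_def by auto
  moreover have "subinvariant X \<mu> (vec d (\<lambda>_. 1))"
  proof (rule subinvariantI[OF X])
    fix i assume i: "i < d"
    have "(\<Sum>j<d. X $$ (i, j) * vec d (\<lambda>_. 1) $ j) = (\<Sum>j<d. if i = j then X $$ (i, i) else 0)"
      by (intro sum.cong) (auto simp: off i)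
    then show "(\<Sum>j<d. X $$ (i, j) * vec d (\<lambda>_. 1) $ j) < \<mu> * vec d (\<lambda>_. 1) $ i"
      using i diag[OF i] by simp
  qed auto
  ultimately show ?thesis using abscissa_less_iff[OF X d] by blast
qed

text \<open>A one-sided continuity statement: no continuity of eigenvalues is needed, because
  \<open>\<theta> X + (1 - \<theta>) Y\<close> dominates \<open>\<theta> X - (1 - \<theta>) c\<close> when \<open>-c\<close> bounds the diagonal of \<open>Y\<close>.\<close>

lemma abscissa_nonpos_limit:
  assumes X: "X \<in> carrier_mat d d" "metzler X" and Y: "Y \<in> carrier_mat d d" "metzler Y"
    and d: "0 < d"
    and neg: "\<And>\<theta> Z. \<lbrakk>0 < \<theta>; \<theta> < 1; Z \<in> carrier_mat d d; metzler Z;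
       \<And>i j. i < d \<Longrightarrow> j < d \<Longrightarrow> Z $$ (i, j) = \<theta> * X $$ (i, j) + (1 - \<theta>) * Y $$ (i, j)\<rbrakk>
      \<Longrightarrow> spectral_abscissa Z < 0"
  shows "spectral_abscissa X \<le> 0"
proof (rule ccontr)
  assume "\<not> ?thesis"
  then have pos: "0 < spectral_abscissa X" by simp
  obtain k where k: "k < d" "\<And>i. i < d \<Longrightarrow> - Y $$ (i, i) \<le> - Y $$ (k, k)"
    using obtain_arg_max_below[OF d, of "\<lambda>i. - Y $$ (i, i)"] by blast
  define c where "c = \<bar>Y $$ (k, k)\<bar>"
  have c: "0 \<le> c" "- c \<le> Y $$ (i, i)" if "i < d" for i using k(2)[OF that] unfolding c_def by auto
  \<comment> \<open>This \<open>\<theta>\<close> solves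
    \<open>\<theta> * \<eta>(X) - (1 - \<theta>) * c = \<eta>(X) / 2\<close>, so the lower bound for
    the abscissa of the convex combination is still positive.\<close>
  define \<theta> where "\<theta> = (c + spectral_abscissa X / 2) / (c + spectral_abscissa X)"
  have c0: "0 \<le> c" unfolding c_def by simp
  have den: "0 < c + spectral_abscissa X" using c0 pos by simp
  have \<theta>: "0 < \<theta>" "\<theta> < 1" using c0 pos den unfolding \<theta>_def by (auto simp: add_nonneg_pos)
  have "\<theta> * (c + spectral_abscissa X) = c + spectral_abscissa X / 2"
    using den unfolding \<theta>_def by simp
  then have large: "(1 - \<theta>) * c < \<theta> * spectral_abscissa X"
    using pos by (simp add: algebra_simps)
  define Z where "Z = mat d d (\<lambda>(i, j). \<theta> * X $$ (i, j) + (1 - \<theta>) * Y $$ (i, j))"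
  have Zn: "Z $$ (i, j) = \<theta> * X $$ (i, j) + (1 - \<theta>) * Y $$ (i, j)" if "i < d" "j < d" for i j
    using that unfolding Z_def by simp
  have Z: "Z \<in> carrier_mat d d" "metzler Z"
    using \<theta> metzlerD[OF X] metzlerD[OF Y] unfolding Z_def metzler_def by auto
  have "\<theta> * spectral_abscissa X - (1 - \<theta>) * c \<le> spectral_abscissa Z"
  proof (rule abscissa_affine_mono[OF X Z d \<theta>(1)])
    fix i j assume ij: "i < d" "j < d"
    have "- c * (1 - \<theta>) \<le> Y $$ (i, i) * (1 - \<theta>)"
      by (rule mult_right_mono) (use c(2)[OF ij(1)] \<theta> in auto)
    moreover have "0 \<le> (1 - \<theta>) * Y $$ (i, j)" if "i \<noteq> j"
      using metzlerD[OF Y ij that] \<theta> by simp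
    ultimately show "\<theta> * X $$ (i, j) - (if i = j then (1 - \<theta>) * c else 0) \<le> Z $$ (i, j)"
      using Zn[OF ij] by (auto simp: algebra_simps)
  qed
  moreover have "spectral_abscissa Z < 0" using neg[OF \<theta> Z Zn] .
  ultimately show False using large by simp
qed

section \<open>Inverses of stable Metzler matrices\<close>

text \<open>Compare \<open>x\<close> with \<open>\<theta> v\<close>, where \<open>\<theta>\<close>
  is the least ratio \<open>x j / v $ j\<close>. In the row where it is attained,
  \<open>X x \<ge> \<theta> X v\<close>, and the right side would be positive if
  \<open>\<theta> < 0\<close>.\<close>

lemma subinvariant_min_principle:
  assumes X: "X \<in> carrier_mat d d" "metzler X" and v: "subinvariant X 0 v"
    and Xx: "\<And>i. i < d \<Longrightarrow> (\<Sum>j<d. X $$ (i, j) * x j) \<le> 0" and k: "k < d"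
  shows "0 \<le> x k"
proof -
  note vD = subinvariantD[OF X(1) v]
  have "0 < d" using k by simp
  then obtain i where i: "i < d" and mx: "\<And>j. j < d \<Longrightarrow> - x j / v $ j \<le> - x i / v $ i"
    using obtain_arg_max_below[of d "\<lambda>j. - x j / v $ j"] by blast
  define \<theta> where "\<theta> = x i / v $ i"
  have xi: "x i = \<theta> * v $ i" using vD(2)[OF i] unfolding \<theta>_def by auto
  have xj: "\<theta> * v $ j \<le> x j" if "j < d" for j
    using mx[OF that] vD(2)[OF that] unfolding \<theta>_def by (simp add: field_simps)
  have "0 \<le> \<theta>"
  proof (rule ccontr)
    assume neg: "\<not> 0 \<le> \<theta>"
    have "\<theta> * (\<Sum>j<d. X $$ (i, j) * v $ j) = (\<Sum>j<d. X $$ (i, j) * (\<theta> * v $ j))"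
      by (simp add: sum_distrib_left mult.left_commute)
    also have "\<dots> \<le> (\<Sum>j<d. X $$ (i, j) * x j)"
    proof (rule sum_mono)
      fix j assume "j \<in> {..<d}"
      then show "X $$ (i, j) * (\<theta> * v $ j) \<le> X $$ (i, j) * x j"
        using xj[of j] xi metzlerD[OF X i, of j] by (cases "i = j") (auto intro: mult_left_mono)
    qed
    also have "\<dots> \<le> 0" by (rule Xx[OF i])
    finally show False using vD(3)[OF i] neg by (simp add: mult_le_0_iff)
  qed
  then show ?thesis using xj[OF k] vD(2)[OF k] by (smt (verit) mult_nonneg_nonneg)
qed

text \<open>The minimum principle applied to a kernel vector and its negative gives invertibility;
  applied to the negated columns of the inverse, which \<open>X\<close> maps to negated unit
  vectors, it gives the signs.\<close>

lemma metzler_stable_inverse: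
  assumes X: "X \<in> carrier_mat d d" "metzler X" and d: "0 < d" and neg: "spectral_abscissa X < 0"
  obtains B where "mat_inverse X = Some B" "B \<in> carrier_mat d d" "X * B = 1\<^sub>m d" "B * X = 1\<^sub>m d"
    "\<And>i j. i < d \<Longrightarrow> j < d \<Longrightarrow> B $$ (i, j) \<le> 0"
proof -
  obtain v where v: "subinvariant X 0 v" using abscissa_less_iff[OF X(1) d X(2)] neg by blast
  have "det X \<noteq> 0"
  proof
    assume "det X = 0"
    then obtain x where x: "x \<in> carrier_vec d" "x \<noteq> 0\<^sub>v d" "X *\<^sub>v x = 0\<^sub>v d"
      using det_0_iff_vec_prod_zero_field[OF X(1)] by blast
    have z: "(\<Sum>j<d. X $$ (i, j) * x $ j) = 0" if "i < d" for i
      using mult_mat_vec_nth[OF X(1) x(1) that] x(3) that by simp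
    have "0 \<le> x $ k \<and> 0 \<le> - x $ k" if "k < d" for k
      using subinvariant_min_principle[OF X v, of "\<lambda>j. x $ j"]
        subinvariant_min_principle[OF X v, of "\<lambda>j. - x $ j"] z that by (simp add: sum_negf)
    then have "x = 0\<^sub>v d" using x(1) by (intro eq_vecI) force+
    with x(2) show False by simp
  qed
  then obtain B where inv: "mat_inverse X = Some B"
    using mat_inverse(1)[OF X(1), where b = "()"] det_non_zero_imp_unit[OF X(1), where b = "()"] by (cases "mat_inverse X") auto
  have B: "X * B = 1\<^sub>m d" "B * X = 1\<^sub>m d" "B \<in> carrier_mat d d"
    using mat_inverse(2)[OF X(1) inv] by auto
  have "B $$ (k, j) \<le> 0" if k: "k < d" and j: "j < d" for k j
  proof -
    have "(\<Sum>l<d. X $$ (i, l) * - B $$ (l, j)) \<le> 0" if i: "i < d" for i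
    proof -
      have "(X * B) $$ (i, j) = (\<Sum>l<d. X $$ (i, l) * B $$ (l, j))"
        using X(1) B(3) i j by (auto simp: scalar_prod_def atLeast0LessThan intro!: sum.cong)
      then show ?thesis unfolding B(1) using i j by (simp add: sum_negf split: if_splits)
    qed
    then show ?thesis using subinvariant_min_principle[OF X v, of "\<lambda>l. - B $$ (l, j)" k] k by simp
  qed
  with inv B show ?thesis using that by blast
qed

section \<open>Nonnegative perturbations of a stable Metzler matrix\<close>

text \<open>\<open>D\<close> carries an eigenvector \<open>x\<close> of \<open>C * D\<close> to one
  of \<open>D * C\<close>; if \<open>D x\<close> vanished, so would \<open>z x\<close>, which
  \<open>z \<noteq> 0\<close> excludes.\<close>

lemma spectrum_mult_swap:
  fixes C D :: "complex mat"
  assumes C: "C \<in> carrier_mat d d" and D: "D \<in> carrier_mat d d"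
    and z: "z \<in> spectrum (C * D)" "z \<noteq> 0"
  shows "z \<in> spectrum (D * C)"
proof -
  have CD: "C * D \<in> carrier_mat d d" and DC: "D * C \<in> carrier_mat d d" using C D by auto
  obtain x where x: "x \<in> carrier_vec d" "x \<noteq> 0\<^sub>v d" "(C * D) *\<^sub>v x = z \<cdot>\<^sub>v x"
    using z(1) spectrum_iff[OF CD] by blast
  have Dx: "D *\<^sub>v x \<in> carrier_vec d" using D x(1) by (rule mult_mat_vec_carrier)
  have CDx: "C *\<^sub>v (D *\<^sub>v x) = z \<cdot>\<^sub>v x" using x(3) assoc_mult_mat_vec[OF C D x(1)] by simp
  have "(D * C) *\<^sub>v (D *\<^sub>v x) = D *\<^sub>v (z \<cdot>\<^sub>v x)"
    using assoc_mult_mat_vec[OF D C Dx] CDx by simp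
  also have "\<dots> = z \<cdot>\<^sub>v (D *\<^sub>v x)" using D x(1) by (rule mult_mat_vec)
  finally have "(D * C) *\<^sub>v (D *\<^sub>v x) = z \<cdot>\<^sub>v (D *\<^sub>v x)" .
  moreover have "D *\<^sub>v x \<noteq> 0\<^sub>v d"
  proof
    assume "D *\<^sub>v x = 0\<^sub>v d"
    moreover have "C *\<^sub>v 0\<^sub>v d = 0\<^sub>v d" using C by (intro eq_vecI) auto
    ultimately have zx: "z \<cdot>\<^sub>v x = 0\<^sub>v d" using CDx by simp
    have "z * x $ i = 0" if "i < d" for i
      using arg_cong[OF zx, of "\<lambda>w. w $ i"] that x(1) by simp
    then have "x = 0\<^sub>v d" using x(1) z(2) by (intro eq_vecI) auto
    with x(2) show False by simp
  qed
  ultimately show ?thesis using Dx spectrum_iff[OF DC] by blast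
qed

text \<open>A zero row of \<open>N\<close> would give a zero row of \<open>N * X = -1\<close>, so
  each row has a positive entry.\<close>

lemma left_invertible_nonneg_positive:
  fixes N :: "real mat"
  assumes N: "N \<in> carrier_mat d d" and X: "X \<in> carrier_mat d d" and NX: "N * X = - 1\<^sub>m d"
    and nn: "\<And>i j. i < d \<Longrightarrow> j < d \<Longrightarrow> 0 \<le> N $$ (i, j)"
    and y: "y \<in> carrier_vec d" "\<And>j. j < d \<Longrightarrow> 0 < y $ j" and i: "i < d"
  shows "0 < (N *\<^sub>v y) $ i"
proof -
  have "\<exists>j<d. N $$ (i, j) \<noteq> 0"
  proof (rule ccontr)
    assume "\<not> ?thesis"
    then have "(N * X) $$ (i, i) = 0" using N X i by (simp add: scalar_prod_def)
    then show False using i unfolding NX by simp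
  qed
  then obtain j where j: "j < d" "0 < N $$ (i, j)" using nn[OF i] by (metis less_eq_real_def)
  have "0 < (\<Sum>j<d. N $$ (i, j) * y $ j)"
    using j i by (intro sum_pos2[of _ j]) (auto simp: nn y(2) less_imp_le)
  then show ?thesis using mult_mat_vec_nth[OF N y(1) i] by simp
qed

text \<open>Both directions transport a subinvariant vector through \<open>N = -X\<^sup>-\<^sup>1 \<ge> 0\<close>. Passing from the radius
  back to the abscissa, the product \<open>H N\<close> is used: it has the radius of \<open>N H\<close>, and
  \<open>(X + s H) N = -1 + s H N\<close>.\<close>

lemma abscissa_perturbation_less_zero_iff:
  assumes X: "X \<in> carrier_mat d d" "metzler X" and d: "0 < d"
    and H: "H \<in> carrier_mat d d" and Hn: "\<And>i j. i < d \<Longrightarrow> j < d \<Longrightarrow> 0 \<le> H $$ (i, j)"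
    and B: "B \<in> carrier_mat d d" "X * B = 1\<^sub>m d" "B * X = 1\<^sub>m d"
      "\<And>i j. i < d \<Longrightarrow> j < d \<Longrightarrow> B $$ (i, j) \<le> 0"
    and s: "0 < s"
  shows "spectral_abscissa (X + s \<cdot>\<^sub>m H) < 0 \<longleftrightarrow> spectral_radius (complexify ((- B) * H)) < 1 / s"
proof -
  define N where "N = - B"
  define Y where "Y = X + s \<cdot>\<^sub>m H"
  have N: "N \<in> carrier_mat d d" using B(1) unfolding N_def by simp
  have Y: "Y \<in> carrier_mat d d" using H unfolding Y_def by simp
  have Nn: "0 \<le> N $$ (i, j)" if "i < d" "j < d" for i j using B(1) B(4)[OF that] that unfolding N_def by simp
  have mY: "metzler Y"
    unfolding metzler_def using Y metzlerD[OF X] Hn H X s by (auto simp: Y_def)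
  have NX: "N * X = - 1\<^sub>m d" and XN: "X * N = - 1\<^sub>m d"
    using B X(1) unfolding N_def by auto
  have sH: "s \<cdot>\<^sub>m H \<in> carrier_mat d d" using H by simp
  have NH: "N * H \<in> carrier_mat d d" and HN: "H * N \<in> carrier_mat d d" using N H by auto
  have NY: "N * Y = - 1\<^sub>m d + s \<cdot>\<^sub>m (N * H)"
    unfolding Y_def mult_add_distrib_mat[OF N X(1) sH] NX mult_smult_distrib[OF N H] ..
  have YN: "Y * N = - 1\<^sub>m d + s \<cdot>\<^sub>m (H * N)"
    unfolding Y_def add_mult_distrib_mat[OF X(1) sH N] XN mult_smult_assoc_mat[OF H N] ..
  have prod_nonneg: "0 \<le> (C * D) $$ (i, j)"
    if "C \<in> carrier_mat d d" "D \<in> carrier_mat d d" "i < d" "j < d"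
      "\<And>i j. i < d \<Longrightarrow> j < d \<Longrightarrow> 0 \<le> C $$ (i, j)" "\<And>i j. i < d \<Longrightarrow> j < d \<Longrightarrow> 0 \<le> D $$ (i, j)"
    for C D :: "real mat" and i j
    using that by (auto simp: scalar_prod_def intro!: sum_nonneg)
  have shifted: "((- 1\<^sub>m d + s \<cdot>\<^sub>m C) *\<^sub>v x) $ i = s * (\<Sum>j<d. C $$ (i, j) * x $ j) - x $ i"
    if C: "C \<in> carrier_mat d d" "x \<in> carrier_vec d" "i < d" for C :: "real mat" and x i
  proof -
    have "((- 1\<^sub>m d + s \<cdot>\<^sub>m C) *\<^sub>v x) $ i = (\<Sum>j<d. (- 1\<^sub>m d + s \<cdot>\<^sub>m C) $$ (i, j) * x $ j)"
      using C by (intro mult_mat_vec_nth) auto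
    also have "\<dots> = (\<Sum>j<d. s * (C $$ (i, j) * x $ j) - (if i = j then x $ j else 0))"
      using C by (intro sum.cong) (auto simp: algebra_simps)
    finally show ?thesis using C by (simp add: sum_subtractf sum_distrib_left)
  qed
  have "spectral_radius (complexify (N * H)) < 1 / s" if "spectral_abscissa Y < 0"
  proof -
    obtain v where v: "subinvariant Y 0 v" using abscissa_less_iff[OF Y d mY] \<open>spectral_abscissa Y < 0\<close> by blast
    note vD = subinvariantD[OF Y v]
    have Yv: "Y *\<^sub>v v \<in> carrier_vec d" using Y vD(1) by (rule mult_mat_vec_carrier)
    have "subinvariant (N * H) (1 / s) v"
    proof (rule subinvariantI[OF NH vD(1,2)])
      fix i assume i: "i < d"
      \<comment> \<open>Here \<open>- Y v\<close> is positive, and \<open>N Y = -1 + s N H\<close>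
        turns \<open>0 < N (- Y v)\<close> into \<open>s N H v < v\<close>.\<close>
      have neg: "- (Y *\<^sub>v v) \<in> carrier_vec d" "\<And>j. j < d \<Longrightarrow> 0 < (- (Y *\<^sub>v v)) $ j"
        using Yv mult_mat_vec_nth[OF Y vD(1)] vD(3) Y by auto
      have "0 < (N *\<^sub>v (- (Y *\<^sub>v v))) $ i"
        by (rule left_invertible_nonneg_positive[OF N X(1) NX Nn neg i])
      also have "\<dots> = - (N *\<^sub>v (Y *\<^sub>v v)) $ i"
        using mult_mat_vec_nth[OF N Yv i] mult_mat_vec_nth[OF N neg(1) i] Yv Y by (simp add: sum_negf)
      also have "N *\<^sub>v (Y *\<^sub>v v) = (N * Y) *\<^sub>v v" using assoc_mult_mat_vec[OF N Y vD(1)] by simp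
      also have "(\<dots>) $ i = s * (\<Sum>j<d. (N * H) $$ (i, j) * v $ j) - v $ i"
        unfolding NY by (rule shifted[OF NH vD(1) i])
      finally show "(\<Sum>j<d. (N * H) $$ (i, j) * v $ j) < 1 / s * v $ i"
        using s by (simp add: field_simps)
    qed
    then show ?thesis
      using radius_less_if_subinvariant[OF NH d] prod_nonneg[OF N H] Nn Hn by blast
  qed
  \<comment> \<open>A subinvariant vector of \<open>N * H\<close> would give only
    \<open>N Y v < 0\<close>, which does not force \<open>Y v < 0\<close>. A subinvariant vector
    \<open>u\<close> of \<open>H * N\<close> gives \<open>Y (N u) < 0\<close> with
    \<open>N u\<close> positive.\<close>
  moreover have "spectral_abscissa Y < 0" if sr: "spectral_radius (complexify (N * H)) < 1 / s"
  proof -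
    have hom: "complexify (H * N) = complexify H * complexify N" "complexify (N * H) = complexify N * complexify H"
      using of_real_hom.mat_hom_mult[OF H N] of_real_hom.mat_hom_mult[OF N H] by auto
    have "cmod z < 1 / s" if z: "z \<in> spectrum (complexify (H * N))" for z
    proof (cases "z = 0")
      case False
      then have "z \<in> spectrum (complexify (N * H))"
        unfolding hom(2) using H N z by (intro spectrum_mult_swap[of "complexify H" d]) (simp_all add: hom(1))
      then show ?thesis using sr spectrum_bounds(2)[OF NH d] by blast
    qed (use s in simp)
    then have "spectral_radius (complexify (H * N)) < 1 / s" using spectrum_bounds(2)[OF HN d] by blast
    then obtain u where u: "subinvariant (H * N) (1 / s) u"
      using subinvariant_if_radius_less[OF HN d] prod_nonneg[OF H N] Nn Hn by blast
    note uD = subinvariantD[OF HN u]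
    have "subinvariant Y 0 (N *\<^sub>v u)"
    proof (rule subinvariantI[OF Y])
      show Nu: "N *\<^sub>v u \<in> carrier_vec d" using N uD(1) by (rule mult_mat_vec_carrier)
      fix i assume i: "i < d"
      show "0 < (N *\<^sub>v u) $ i" by (rule left_invertible_nonneg_positive[OF N X(1) NX Nn uD(1,2) i])
      have "(\<Sum>j<d. Y $$ (i, j) * (N *\<^sub>v u) $ j) = (Y *\<^sub>v (N *\<^sub>v u)) $ i"
        by (rule mult_mat_vec_nth[OF Y Nu i, symmetric])
      also have "Y *\<^sub>v (N *\<^sub>v u) = (Y * N) *\<^sub>v u" using assoc_mult_mat_vec[OF Y N uD(1)] by simp
      also have "(\<dots>) $ i = s * (\<Sum>j<d. (H * N) $$ (i, j) * u $ j) - u $ i"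
        unfolding YN by (rule shifted[OF HN uD(1) i])
      also have "\<dots> < 0 * (N *\<^sub>v u) $ i" using uD(3)[OF i] s by (simp add: field_simps)
      finally show "(\<Sum>j<d. Y $$ (i, j) * (N *\<^sub>v u) $ j) < 0 * (N *\<^sub>v u) $ i" .
    qed
    then show ?thesis using abscissa_less_iff[OF Y d mY] by blast
  qed
  ultimately show ?thesis unfolding N_def Y_def by blast
qed

section \<open>The truncated family and the optimal value\<close>

lemma reduced_carrier [simp]: "A \<in> carrier_mat d d \<Longrightarrow> reduced A t \<in> carrier_mat d d"
  unfolding reduced_def by auto

lemma reduced_nth:
  assumes "A \<in> carrier_mat d d" "i < d" "j < d"
  shows "reduced A t $$ (i, j) = (if i = j then A $$ (i, j) - t else max 0 (A $$ (i, j) - t))"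
  using assms unfolding reduced_def by auto

lemma metzler_reduced: "A \<in> carrier_mat d d \<Longrightarrow> metzler (reduced A t)"
  unfolding metzler_def reduced_def by auto

lemma reduced_zero:
  assumes "A \<in> carrier_mat d d" "metzler A"
  shows "reduced A 0 = A"
proof (rule eq_matI)
  show "dim_row (reduced A 0) = dim_row A" "dim_col (reduced A 0) = dim_col A"
    unfolding reduced_def by auto
qed (use assms metzlerD[OF assms] in \<open>auto simp: reduced_nth\<close>)

text \<open>\<open>A(t)\<close> plus the scalar matrix \<open>t - s\<close> lies entrywise below
  \<open>A(s)\<close>. Hence the abscissa strictly decreases along the family and has at most one
  root.\<close>

lemma abscissa_reduced_le:
  assumes A: "A \<in> carrier_mat d d" and d: "0 < d" and st: "s \<le> t"
  shows "spectral_abscissa (reduced A t) + (t - s) \<le> spectral_abscissa (reduced A s)"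
proof -
  have "1 * spectral_abscissa (reduced A t) - (s - t) \<le> spectral_abscissa (reduced A s)"
    using A st
    by (intro abscissa_affine_mono[of _ d] metzler_reduced[of _ d] d) (auto simp: reduced_nth)
  then show ?thesis by simp
qed

lemma max_norm_le_iff:
  assumes X: "X \<in> carrier_mat d d" and d: "0 < d"
  shows "max_norm X \<le> c \<longleftrightarrow> (\<forall>i<d. \<forall>j<d. \<bar>X $$ (i, j)\<bar> \<le> c)"
proof -
  have E: "elements_mat X = (\<lambda>(i, j). X $$ (i, j)) ` ({..<d} \<times> {..<d})"
    using X elements_matI[OF X] by (force dest: elements_matD)
  have "finite (abs ` elements_mat X)" "abs ` elements_mat X \<noteq> {}" using d unfolding E by auto
  then have "max_norm X \<le> c \<longleftrightarrow> (\<forall>a\<in>elements_mat X. \<bar>a\<bar> \<le> c)" unfolding max_norm_def by simp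
  also have "\<dots> \<longleftrightarrow> (\<forall>i<d. \<forall>j<d. \<bar>X $$ (i, j)\<bar> \<le> c)" unfolding E by auto
  finally show ?thesis .
qed

text \<open>A Metzler matrix at distance \<open>r\<close> from \<open>A\<close> dominates \<open>A(r)\<close> entrywise, hence in abscissa.\<close>

lemma reduced_root_optimal:
  assumes A: "A \<in> carrier_mat d d" "metzler A" and d: "0 < d"
    and \<tau>: "0 \<le> \<tau>" "spectral_abscissa (reduced A \<tau>) = 0"
  shows "is_arg_min (\<lambda>X. max_norm (X - A)) (\<lambda>X. X \<in> stable_metzler d) (reduced A \<tau>)"
    and "max_norm (reduced A \<tau> - A) = \<tau>"
proof -
  \<comment> \<open>Subtraction takes its dimensions from the second operand, so \<open>X\<close> is
    arbitrary here.\<close>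
  have D: "X - A \<in> carrier_mat d d" for X using A by (auto simp: minus_mat_def)
  have "max_norm (reduced A \<tau> - A) \<le> \<tau>"
    unfolding max_norm_le_iff[OF D d] using A(1) metzlerD[OF A] \<tau>(1) by (auto simp: reduced_nth max_def)
  \<comment> \<open>A diagonal entry moves by exactly \<open>\<tau>\<close>, so the distance is
    attained.\<close>
  moreover have "\<bar>(reduced A \<tau> - A) $$ (0, 0)\<bar> \<le> max_norm (reduced A \<tau> - A)"
    using max_norm_le_iff[OF D d, of "reduced A \<tau>" "max_norm (reduced A \<tau> - A)"] d by blast
  then have "\<tau> \<le> max_norm (reduced A \<tau> - A)" using A(1) d \<tau>(1) by (simp add: reduced_nth)
  ultimately show norm: "max_norm (reduced A \<tau> - A) = \<tau>" by simp
  have "\<tau> \<le> max_norm (X - A)" if "X \<in> stable_metzler d" for X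
  proof (rule ccontr)
    define r where "r = max_norm (X - A)"
    assume "\<not> \<tau> \<le> max_norm (X - A)"
    then have r: "r < \<tau>" unfolding r_def by simp
    have X: "X \<in> carrier_mat d d" "metzler X" "spectral_abscissa X \<le> 0"
      using that unfolding stable_metzler_def by auto
    have "\<bar>(X - A) $$ (i, j)\<bar> \<le> r" if "i < d" "j < d" for i j
      using max_norm_le_iff[OF D d, of X r] that unfolding r_def by blast
    then have ge: "A $$ (i, j) - r \<le> X $$ (i, j)" if "i < d" "j < d" for i j
      using that X(1) A(1) by (fastforce simp: abs_le_iff)
    have "1 * spectral_abscissa (reduced A r) - 0 \<le> spectral_abscissa X"
      by (rule abscissa_affine_mono[OF reduced_carrier[OF A(1)] metzler_reduced[OF A(1)] X(1,2) d])
        (use ge metzlerD[OF X(1,2)] in \<open>auto simp: reduced_nth[OF A(1)]\<close>)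
    \<comment> \<open>Strict decrease gives \<open>\<eta>(A(r)) \<ge> \<tau> - r > 0\<close>,
      against \<open>\<eta>(X) \<le> 0\<close>.\<close>
    then show False using abscissa_reduced_le[OF A(1) d, of r \<tau>] r \<tau>(2) X(3) by simp
  qed
  moreover have "reduced A \<tau> \<in> stable_metzler d"
    using A \<tau> metzler_reduced unfolding stable_metzler_def by auto
  ultimately show "is_arg_min (\<lambda>X. max_norm (X - A)) (\<lambda>X. X \<in> stable_metzler d) (reduced A \<tau>)"
    unfolding is_arg_min_def norm by (auto simp: not_less)
qed

lemma reduced_root_unique:
  assumes A: "A \<in> carrier_mat d d" and d: "0 < d"
    and "spectral_abscissa (reduced A s) = 0" "spectral_abscissa (reduced A t) = 0"
  shows "s = t"
  using abscissa_reduced_le[OF A d, of s t] abscissa_reduced_le[OF A d, of t s] assms(3,4)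
  by linarith

section \<open>The value returned by each rule\<close>

lemma positive_entries_iff:
  assumes "A \<in> carrier_mat d d"
  shows "a \<in> positive_entries A \<longleftrightarrow> 0 < a \<and> (\<exists>i<d. \<exists>j<d. a = A $$ (i, j))"
proof -
  have "a \<in> elements_mat A \<longleftrightarrow> (\<exists>i<d. \<exists>j<d. a = A $$ (i, j))"
    using assms by (auto dest!: elements_matD intro: elements_matI[OF assms])
  then show ?thesis unfolding positive_entries_def by auto
qed

lemma finite_positive_entries: "finite (positive_entries A)"
  unfolding positive_entries_def elements_mat_def by simp

lemma reduced_above_entries:
  assumes A: "A \<in> carrier_mat d d" and t: "0 \<le> t" "\<And>a. a \<in> positive_entries A \<Longrightarrow> a \<le> t"
    and ij: "i < d" "j < d"
  shows "A $$ (i, j) \<le> t" "i \<noteq> j \<Longrightarrow> reduced A t $$ (i, j) = 0"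
proof -
  show le: "A $$ (i, j) \<le> t"
    using t positive_entries_iff[OF A, of "A $$ (i, j)"] ij by (cases "0 < A $$ (i, j)") auto
  show "reduced A t $$ (i, j) = 0" if "i \<noteq> j" using reduced_nth[OF A ij] le that by simp
qed

text \<open>Truncating at the highest entry clears every off-diagonal entry and leaves a nonpositive
  diagonal that contains a zero.\<close>

lemma diagonal_root:
  assumes A: "A \<in> carrier_mat d d" and d: "0 < d" and hd: "highest_on_diagonal A"
    and \<tau>: "\<tau> = Max {A $$ (i, i) | i. i < dim_row A}"
  shows "0 \<le> \<tau>" "spectral_abscissa (reduced A \<tau>) = 0"
proof -
  obtain k where k: "k < d" "A $$ (k, k) \<in> positive_entries A"
      "\<And>a. a \<in> positive_entries A \<Longrightarrow> a \<le> A $$ (k, k)"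
    using hd A unfolding highest_on_diagonal_def by auto
  have pos: "0 < A $$ (k, k)" using k(2) positive_entries_iff[OF A] by simp
  have le: "A $$ (i, i) \<le> A $$ (k, k)" if "i < d" for i
    using reduced_above_entries(1)[OF A _ k(3) that that] pos by simp
  have "{A $$ (i, i) | i. i < dim_row A} = (\<lambda>i. A $$ (i, i)) ` {..<d}" using A by auto
  then have \<tau>k: "\<tau> = A $$ (k, k)"
    unfolding \<tau> using le k(1) by (auto intro!: Max_eqI)
  then show "0 \<le> \<tau>" using pos by simp
  \<comment> \<open>The criterion for diagonal matrices is strict, so the abscissa is shown to lie
    below every positive \<open>\<mu>\<close>.\<close>
  have "spectral_abscissa (reduced A \<tau>) < \<mu>" if "0 < \<mu>" for \<mu>
  proof (rule abscissa_diagonal_less[OF reduced_carrier[OF A] d])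
    show "reduced A \<tau> $$ (i, j) = 0" if "i < d" "j < d" "i \<noteq> j" for i j
      using reduced_above_entries(2)[OF A _ k(3)] that pos \<tau>k by simp
    show "reduced A \<tau> $$ (i, i) < \<mu>" if "i < d" for i
      using le[OF that] \<tau>k \<open>0 < \<mu>\<close> that by (simp add: reduced_nth[OF A])
  qed
  then have "spectral_abscissa (reduced A \<tau>) \<le> 0" by (meson less_irrefl not_le)
  moreover have "reduced A \<tau> $$ (k, k) \<le> spectral_abscissa (reduced A \<tau>)"
    by (rule diagonal_le_abscissa[OF reduced_carrier[OF A] metzler_reduced[OF A] k(1)])
  ultimately show "spectral_abscissa (reduced A \<tau>) = 0" using \<tau>k k(1) by (simp add: reduced_nth[OF A])
qed

lemma interpolation_root:
  assumes A: "A \<in> carrier_mat d d" and d: "0 < d"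
    and \<tau>: "0 \<le> \<tau>1" "\<tau>1 < \<tau>2"
    and gap: "\<And>a. a \<in> positive_entries A \<Longrightarrow> a \<le> \<tau>1 \<or> \<tau>2 \<le> a"
    and pos: "0 < spectral_abscissa (reduced A \<tau>1)" and neg: "spectral_abscissa (reduced A \<tau>2) < 0"
    and H: "H = (1 / (\<tau>2 - \<tau>1)) \<cdot>\<^sub>m (reduced A \<tau>1 - reduced A \<tau>2)"
    and inv: "mat_inverse (reduced A \<tau>2) = Some B"
    and \<rho>: "\<rho> = spectral_radius (complexify ((- B) * H))"
  shows "\<rho> \<noteq> 0" "0 \<le> \<tau>2 - 1 / \<rho>" "spectral_abscissa (reduced A (\<tau>2 - 1 / \<rho>)) = 0"
proof -
  note R = reduced_carrier[OF A] and M = metzler_reduced[OF A] and nth = reduced_nth[OF A]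
  have Hc: "H \<in> carrier_mat d d" unfolding H using R[of \<tau>2] by (simp add: minus_carrier_mat)
  have dich: "A $$ (i, j) \<le> \<tau>1 \<or> \<tau>2 \<le> A $$ (i, j)" if "i < d" "j < d" for i j
    using gap[of "A $$ (i, j)"] positive_entries_iff[OF A, of "A $$ (i, j)"] that \<tau>
    by (cases "0 < A $$ (i, j)") auto
  \<comment> \<open>An off-diagonal entry at most \<open>\<tau>1\<close> is truncated at both ends;
    one at least \<open>\<tau>2\<close> survives and, like the diagonal, moves at unit rate.\<close>
  have Hnth: "H $$ (i, j) = (if i = j \<or> \<tau>2 \<le> A $$ (i, j) then 1 else 0)" if ij: "i < d" "j < d" for i j
  proof -
    have "H $$ (i, j) = (reduced A \<tau>1 $$ (i, j) - reduced A \<tau>2 $$ (i, j)) / (\<tau>2 - \<tau>1)"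
      unfolding H using R[of \<tau>1] R[of \<tau>2] ij by simp
    then show ?thesis using dich[OF ij] \<tau> by (auto simp: nth[OF ij] max_def)
  qed
  have affine: "reduced A (\<tau>2 - s) = reduced A \<tau>2 + s \<cdot>\<^sub>m H" if s: "0 \<le> s" "s \<le> \<tau>2 - \<tau>1" for s
  proof (rule eq_matI)
    fix i j assume "i < dim_row (reduced A \<tau>2 + s \<cdot>\<^sub>m H)" "j < dim_col (reduced A \<tau>2 + s \<cdot>\<^sub>m H)"
    then have ij: "i < d" "j < d" using Hc by auto
    then show "reduced A (\<tau>2 - s) $$ (i, j) = (reduced A \<tau>2 + s \<cdot>\<^sub>m H) $$ (i, j)"
      using Hc R[of \<tau>2] dich[OF ij] \<tau> s by (auto simp: nth Hnth max_def)
  qed (use Hc R[of \<tau>2] R[of "\<tau>2 - s"] in auto)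
  obtain B' where B': "mat_inverse (reduced A \<tau>2) = Some B'" "B' \<in> carrier_mat d d"
      "reduced A \<tau>2 * B' = 1\<^sub>m d" "B' * reduced A \<tau>2 = 1\<^sub>m d"
      "\<And>i j. i < d \<Longrightarrow> j < d \<Longrightarrow> B' $$ (i, j) \<le> 0"
    using metzler_stable_inverse[OF R M d neg] by metis
  have "B' = B" using inv B'(1) by simp
  note B = B'(2-5)[unfolded this]
  have iff: "spectral_abscissa (reduced A (\<tau>2 - s)) < 0 \<longleftrightarrow> \<rho> < 1 / s"
    if s: "0 < s" "s \<le> \<tau>2 - \<tau>1" for s
    unfolding \<rho> affine[OF less_imp_le[OF s(1)] s(2)]
    by (rule abscissa_perturbation_less_zero_iff[OF R M d Hc _ B s(1)]) (auto simp: Hnth)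
  \<comment> \<open>At \<open>s = \<tau>2 - \<tau>1\<close> the matrix is \<open>A(\<tau>1)\<close>,
    of positive abscissa. This bounds \<open>\<rho>\<close> from below, so \<open>\<rho>\<close> is
    positive and \<open>\<tau>2 - 1 / \<rho>\<close> is at least \<open>\<tau>1\<close>.\<close>
  have low: "1 / (\<tau>2 - \<tau>1) \<le> \<rho>" using iff[of "\<tau>2 - \<tau>1"] \<tau> pos by simp
  moreover have "0 < 1 / (\<tau>2 - \<tau>1)" using \<tau> by simp
  ultimately have \<rho>0: "0 < \<rho>" by linarith
  have s0: "1 / \<rho> \<le> \<tau>2 - \<tau>1" using low \<rho>0 \<tau> by (simp add: field_simps)
  show "\<rho> \<noteq> 0" "0 \<le> \<tau>2 - 1 / \<rho>" using \<rho>0 s0 \<tau> by auto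
  \<comment> \<open>At \<open>s = 1 / \<rho>\<close> the equivalence yields only that the abscissa
    is not negative. The other inequality comes from the values \<open>s = \<theta> / \<rho>\<close>
    with \<open>\<theta> < 1\<close>: by affinity their matrices are the convex combinations with
    \<open>A(\<tau>2)\<close>.\<close>
  have "spectral_abscissa (reduced A (\<tau>2 - 1 / \<rho>)) \<le> 0"
  proof (rule abscissa_nonpos_limit[OF R M R M d])
    fix \<theta> :: real and Z
    assume \<theta>: "0 < \<theta>" "\<theta> < 1" and Z: "Z \<in> carrier_mat d d"
      and Zn: "\<And>i j. i < d \<Longrightarrow> j < d \<Longrightarrow>
        Z $$ (i, j) = \<theta> * reduced A (\<tau>2 - 1 / \<rho>) $$ (i, j) + (1 - \<theta>) * reduced A \<tau>2 $$ (i, j)"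
    have "\<theta> * (1 / \<rho>) < 1 * (1 / \<rho>)" using \<theta> \<rho>0 by (intro mult_strict_right_mono) auto
    then have s: "0 < \<theta> / \<rho>" "\<theta> / \<rho> \<le> \<tau>2 - \<tau>1" using \<theta> \<rho>0 s0 by auto
    have "Z = reduced A (\<tau>2 - \<theta> / \<rho>)"
    proof (rule eq_matI)
      fix i j assume "i < dim_row (reduced A (\<tau>2 - \<theta> / \<rho>))" "j < dim_col (reduced A (\<tau>2 - \<theta> / \<rho>))"
      then have ij: "i < d" "j < d" using R[of "\<tau>2 - \<theta> / \<rho>"] by auto
      have "reduced A (\<tau>2 - 1 / \<rho>) $$ (i, j) = reduced A \<tau>2 $$ (i, j) + 1 / \<rho> * H $$ (i, j)"
        "reduced A (\<tau>2 - \<theta> / \<rho>) $$ (i, j) = reduced A \<tau>2 $$ (i, j) + \<theta> / \<rho> * H $$ (i, j)"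
        using affine[of "1 / \<rho>"] affine[of "\<theta> / \<rho>"] s s0 \<rho>0 Hc R[of \<tau>2] ij by auto
      then show "Z $$ (i, j) = reduced A (\<tau>2 - \<theta> / \<rho>) $$ (i, j)"
        by (simp add: Zn[OF ij] algebra_simps)
    qed (use Z R[of "\<tau>2 - \<theta> / \<rho>"] in auto)
    moreover have "\<rho> < 1 / (\<theta> / \<rho>)" using \<theta> \<rho>0 by (simp add: field_simps)
    ultimately show "spectral_abscissa Z < 0" using iff[OF s] by simp
  qed
  moreover have "\<not> spectral_abscissa (reduced A (\<tau>2 - 1 / \<rho>)) < 0"
    using iff[of "1 / \<rho>"] \<rho>0 s0 by simp
  ultimately show "spectral_abscissa (reduced A (\<tau>2 - 1 / \<rho>)) = 0" by simp
qed

text \<open>As no positive entry is an exact root, the sign of the abscissa decides the side. This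
  gap is what makes \<open>A(\<tau>)\<close> affine between \<open>\<tau>1\<close> and
  \<open>\<tau>2\<close>.\<close>

lemma bisection_gap:
  assumes ne: "\<forall>t \<in> positive_entries A. spectral_abscissa (reduced A t) \<noteq> 0"
    and max: "\<forall>t \<in> insert 0 (positive_entries A). spectral_abscissa (reduced A t) > 0 \<longrightarrow> t \<le> \<tau>1"
    and min: "\<forall>t \<in> positive_entries A. spectral_abscissa (reduced A t) < 0 \<longrightarrow> \<tau>2 \<le> t"
    and a: "a \<in> positive_entries A"
  shows "a \<le> \<tau>1 \<or> \<tau>2 \<le> a"
proof (cases "0 < spectral_abscissa (reduced A a)")
  case True
  then show ?thesis using max a by blast
next
  case False
  then have "spectral_abscissa (reduced A a) < 0" using ne a by (metis linorder_neqE_linordered_idom)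
  then show ?thesis using min a by blast
qed

lemma abscissa_pos_imp_before:
  assumes A: "A \<in> carrier_mat d d" and d: "0 < d"
    and "0 < spectral_abscissa (reduced A s)" "spectral_abscissa (reduced A t) < 0"
  shows "s < t"
  using abscissa_reduced_le[OF A d, of t s] assms(3,4) by linarith

text \<open>Every rule is reduced to a root of the same function, so optimality and uniqueness are
  proved once for all rules.\<close>

lemma closest_stable_tau_root:
  assumes A: "A \<in> carrier_mat d d" and d: "0 < d" and run: "closest_stable_tau A \<tau>"
  shows "0 \<le> \<tau> \<and> spectral_abscissa (reduced A \<tau>) = 0"
  using run
proof cases
  case diagonal
  then show ?thesis using diagonal_root[OF A d] by blast
next
  case exact_root
  then show ?thesis unfolding positive_entries_def by auto
next
  case (interpolation \<tau>1 \<tau>2 H B \<rho>)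
  have "0 \<le> \<tau>1" using interpolation(4) unfolding positive_entries_def by auto
  moreover have "\<tau>1 < \<tau>2" using abscissa_pos_imp_before[OF A d] interpolation by blast
  ultimately show ?thesis
    unfolding interpolation(1)
    using interpolation_root[OF A d _ _ bisection_gap[OF interpolation(3,6,9)]] interpolation by blast
qed

section \<open>Existence of a successful run\<close>

text \<open>Truncating at the highest positive entry leaves a diagonal matrix, and since that entry
  is not on the diagonal, all diagonal entries become negative.\<close>

lemma abscissa_neg_at_highest_entry:
  assumes A: "A \<in> carrier_mat d d" "metzler A" and d: "0 < d" and pos: "0 < spectral_abscissa A"
    and nhd: "\<not> highest_on_diagonal A"
  obtains t where "t \<in> positive_entries A" "spectral_abscissa (reduced A t) < 0"
proof -
  \<comment> \<open>Otherwise \<open>A = A(0)\<close> would be diagonal with nonpositive entries;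
    \<open>\<eta>(A) > 0\<close> would exceed all of them and hence exceed itself.\<close>
  have "positive_entries A \<noteq> {}"
  proof
    assume "positive_entries A = {}"
    then have "A $$ (i, j) \<le> 0" "i \<noteq> j \<Longrightarrow> reduced A 0 $$ (i, j) = 0" if "i < d" "j < d" for i j
      using reduced_above_entries[OF A(1) order_refl _ that] by auto
    then have "spectral_abscissa A < spectral_abscissa A"
      using pos unfolding reduced_zero[OF A]
      by (intro abscissa_diagonal_less[OF A(1) d]) (auto intro: order.strict_trans1)
    then show False by simp
  qed
  then have "Max (positive_entries A) \<in> positive_entries A"
    using finite_positive_entries by (intro Max_in) auto
  then obtain t where t: "t \<in> positive_entries A" "\<And>a. a \<in> positive_entries A \<Longrightarrow> a \<le> t"
    using finite_positive_entries Max_ge by metis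
  have t0: "0 < t" using t(1) positive_entries_iff[OF A(1)] by simp
  have "spectral_abscissa (reduced A t) < 0"
  proof (rule abscissa_diagonal_less[OF reduced_carrier[OF A(1)] d])
    show "reduced A t $$ (i, j) = 0" if "i < d" "j < d" "i \<noteq> j" for i j
      using reduced_above_entries(2)[OF A(1) _ t(2)] that t0 by simp
    show "reduced A t $$ (i, i) < 0" if i: "i < d" for i
    proof -
      have "A $$ (i, i) \<noteq> t" using nhd t i A(1) unfolding highest_on_diagonal_def by auto
      then show ?thesis
        using reduced_above_entries(1)[OF A(1) _ t(2) i i] t0 i by (simp add: reduced_nth[OF A(1)])
    qed
  qed
  with t(1) show ?thesis using that by blast
qed

text \<open>The premises of \<open>interpolation\<close> have to be supplied: both bisection sets
  are finite and nonempty, \<open>A(\<tau>2)\<close> is stable and so invertible, and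
  \<open>\<rho> \<noteq> 0\<close>.\<close>

lemma closest_stable_tau_exists:
  assumes A: "A \<in> carrier_mat d d" "metzler A" and d: "0 < d" and pos: "0 < spectral_abscissa A"
  shows "\<exists>\<tau>. closest_stable_tau A \<tau>"
proof (cases "highest_on_diagonal A")
  case True
  then show ?thesis using closest_stable_tau.diagonal by blast
next
  case nhd: False
  show ?thesis
  proof (cases "\<exists>t\<in>positive_entries A. spectral_abscissa (reduced A t) = 0")
    case True
    then show ?thesis using closest_stable_tau.exact_root[OF nhd] by blast
  next
    case False
    then have ne: "\<forall>t \<in> positive_entries A. spectral_abscissa (reduced A t) \<noteq> 0" by blast
    define S1 where "S1 = {t \<in> insert 0 (positive_entries A). 0 < spectral_abscissa (reduced A t)}"
    define S2 where "S2 = {t \<in> positive_entries A. spectral_abscissa (reduced A t) < 0}"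
    have fin: "finite S1" "finite S2" unfolding S1_def S2_def using finite_positive_entries by auto
    \<comment> \<open>The candidate 0 stands for \<open>A\<close> itself, so the maximum exists even
      if no positive entry has positive abscissa.\<close>
    have "0 \<in> S1" using pos reduced_zero[OF A] unfolding S1_def by simp
    then have "Max S1 \<in> S1" using fin by (intro Max_in) auto
    then obtain \<tau>1 where \<tau>1: "\<tau>1 \<in> S1" "\<And>t. t \<in> S1 \<Longrightarrow> t \<le> \<tau>1" using fin Max_ge by metis
    have "S2 \<noteq> {}" using abscissa_neg_at_highest_entry[OF A d pos nhd] unfolding S2_def by blast
    then have "Min S2 \<in> S2" using fin by (intro Min_in) auto
    then obtain \<tau>2 where \<tau>2: "\<tau>2 \<in> S2" "\<And>t. t \<in> S2 \<Longrightarrow> \<tau>2 \<le> t" using fin Min_le by metis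
    have 1: "\<tau>1 \<in> insert 0 (positive_entries A)" "0 < spectral_abscissa (reduced A \<tau>1)"
      "\<forall>t \<in> insert 0 (positive_entries A). spectral_abscissa (reduced A t) > 0 \<longrightarrow> t \<le> \<tau>1"
      using \<tau>1 unfolding S1_def by blast+
    have 2: "\<tau>2 \<in> positive_entries A" "spectral_abscissa (reduced A \<tau>2) < 0"
      "\<forall>t \<in> positive_entries A. spectral_abscissa (reduced A t) < 0 \<longrightarrow> \<tau>2 \<le> t"
      using \<tau>2 unfolding S2_def by blast+
    have "0 \<le> \<tau>1" using 1(1) unfolding positive_entries_def by auto
    have lt: "\<tau>1 < \<tau>2" by (rule abscissa_pos_imp_before[OF A(1) d 1(2) 2(2)])
    obtain B where B: "mat_inverse (reduced A \<tau>2) = Some B"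
      using metzler_stable_inverse[OF reduced_carrier[OF A(1)] metzler_reduced[OF A(1)] d 2(2)] by metis
    show ?thesis
      using closest_stable_tau.interpolation[OF nhd ne 1 2 _ refl B refl]
        interpolation_root(1)[OF A(1) d \<open>0 \<le> \<tau>1\<close> lt bisection_gap[OF ne 1(3) 2(3)] 1(2) 2(2) refl B refl] lt
      by blast
  qed
qed

theorem theorem3:
  fixes A :: "real mat" and d :: nat
  assumes "0 < d"
    and "A \<in> carrier_mat d d"
    and "metzler A"
    and "0 < spectral_abscissa A"
  shows "(\<exists>!\<tau>. closest_stable_tau A \<tau>) \<and>
    (\<forall>\<tau>. closest_stable_tau A \<tau> \<longrightarrow>
       is_arg_min (\<lambda>X. max_norm (X - A)) (\<lambda>X. X \<in> stable_metzler d) (reduced A \<tau>) \<and>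
       max_norm (reduced A \<tau> - A) = \<tau>)"
proof (intro conjI allI impI)
  note root = closest_stable_tau_root[OF assms(2,1)]
  show "\<exists>!\<tau>. closest_stable_tau A \<tau>"
    using closest_stable_tau_exists[OF assms(2,3,1,4)] root reduced_root_unique[OF assms(2,1)] by blast
  fix \<tau> assume "closest_stable_tau A \<tau>"
  then show "is_arg_min (\<lambda>X. max_norm (X - A)) (\<lambda>X. X \<in> stable_metzler d) (reduced A \<tau>)"
    and "max_norm (reduced A \<tau> - A) = \<tau>"
    using root reduced_root_optimal[OF assms(2,3,1)] by blast+
qed

end
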